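(* Let $f=f_1+f_2$ on $\mathbb{R}^m$, where $f_1:\mathbb{R}^m\to\mathbb{R}\cup\{+\infty\}$ is a proper, closed and convex function and $f_2:\mathbb{R}^m\to\mathbb{R}$ is convex with $L_{f_2}$-Lipschitz continuous gradient. Let $A\in\mathbb{R}^{p\times m}$, $b\in\mathbb{R}^p$, and suppose the set $\Omega$ of saddle points of $\mathcal{L}(x,\lambda)=f(x)+\langle\lambda,Ax-b\rangle$ is nonempty. Let $\{x_k\}_{k\ge1}$ be generated by Algorithm 7 (described in the context) with parameters $\alpha,\gamma>0$, and let $(x^*,\lambda^* )\in\Omega$. Assume $\alpha\le\frac{1}{L_{f_2}}$ and that $\{t_k\}_{k\ge1}\subseteq[1,+\infty)$ is a nondecreasing sequence satisfying $t_{k+1}^2\le t_k^2+t_{k+1}$ for all $k\ge1$. Then for all $k\ge1$: $$\|Ax_k-b\|\le\frac{C_3}{t_k^2},\qquad |f(x_k)-f(x^* )|\le\frac{\mathcal{E}_1+C_3\|\lambda^*\|}{t_k^2},$$ where $$\mathcal{E}_1=t_1^2\big(f(x_1)-f(x^* )+\langle\lambda^*,Ax_1-b\rangle\big)+\frac{1}{2\alpha}\|x_1-x^*\|^2+\frac{1}{2\gamma}\|\lambda_1-\lambda^*\|^2,$$ $$C_3=3t_1^2\|Ax_1-b\|+\frac{2\|\lambda_1-\lambda^*\|+2\sqrt{2\gamma\mathcal{E}_1}}{\gamma}.$$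
   Context: Norms are Euclidean. $dom(F)=\{x: F(x)<+\infty\}$; $F$ is proper if $dom(F)\ne\emptyset$; $F$ is closed if $F(x)\le\liminf_{y\to x}F(y)$ for all $x$ and $dom(F)$ is closed. $1/0$ is read as $+\infty$ in step-size bounds. A saddle point is a pair $(x^*,\lambda^* )$ with $\mathcal{L}(x^*,\lambda)\le\mathcal{L}(x^*,\lambda^* )\le\mathcal{L}(x,\lambda^* )$ for all $(x,\lambda)$. Algorithm 7 (for $\min f(x)$ s.t. $Ax=b$). Initialize $x_1=x_0=u_1\in dom(f)$, $\lambda_1\in\mathbb{R}^p$. For $k=1,2,\dots$: - $\bar x_k=x_k+\frac{t_k-1}{t_{k+1}}(x_k-x_{k-1})$; - $u_{k+1}=\arg\min_u\big(f_1(u)+\langle A^T\lambda_k+\nabla f_2(\bar x_k),u\rangle+\frac{\gamma t_{k+1}}{2}\|Au-b\|^2+\frac{1}{2\alpha t_{k+1}}\|u-u_k\|^2\big)$; - $x_{k+1}=\frac{1}{t_{k+1}}u_{k+1}+\frac{t_{k+1}-1}{t_{k+1}}x_k$; - $\lambda_{k+1}=\lambda_k+\gamma t_{k+1}(Au_{k+1}-b)$. *)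

theory Defs
  imports "HOL-Analysis.Analysis"
begin

text \<open>Functions into \<open>\<real> \<union> {+\<infinity>}\<close> are \<open>ereal\<close>-valued functions that never
  take the value \<open>-\<infinity>\<close>; the latter is a separate hypothesis wherever it is needed.\<close>

definition edom :: "('a \<Rightarrow> ereal) \<Rightarrow> 'a set" where
  "edom F = {x. F x < \<infinity>}"

definition proper_fun :: "('a \<Rightarrow> ereal) \<Rightarrow> bool" where
  "proper_fun F \<longleftrightarrow> edom F \<noteq> {}"

definition closed_fun :: "('a::topological_space \<Rightarrow> ereal) \<Rightarrow> bool" where
  "closed_fun F \<longleftrightarrow> (\<forall>x. F x \<le> Liminf (at x) F) \<and> closed (edom F)"

text \<open>Note that \<open>0 * \<infinity> = 0\<close> in \<open>ereal\<close>, so the end points \<open>c = 0\<close> and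
  \<open>c = 1\<close> impose no condition.\<close>

definition econvex_fun :: "('a::real_vector \<Rightarrow> ereal) \<Rightarrow> bool" where
  "econvex_fun F \<longleftrightarrow> (\<forall>x y. \<forall>c\<in>{0..1}.
     F (c *\<^sub>R x + (1 - c) *\<^sub>R y) \<le> ereal c * F x + ereal (1 - c) * F y)"

definition lagrangian ::
  "(real^'m \<Rightarrow> ereal) \<Rightarrow> real^'m^'p \<Rightarrow> real^'p \<Rightarrow> real^'m \<Rightarrow> real^'p \<Rightarrow> ereal" where
  "lagrangian f A b x l = f x + ereal (l \<bullet> (A *v x - b))"

definition saddle_points ::
  "(real^'m \<Rightarrow> ereal) \<Rightarrow> real^'m^'p \<Rightarrow> real^'p \<Rightarrow> ((real^'m) \<times> (real^'p)) set" where
  "saddle_points f A b = {(xs, ls). \<forall>x l.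
     lagrangian f A b xs l \<le> lagrangian f A b xs ls \<and>
     lagrangian f A b xs ls \<le> lagrangian f A b x ls}"

definition extrapolated :: "(nat \<Rightarrow> real) \<Rightarrow> (nat \<Rightarrow> real^'m) \<Rightarrow> nat \<Rightarrow> real^'m" where
  "extrapolated t x k = x k + ((t k - 1) / t (k + 1)) *\<^sub>R (x k - x (k - 1))"

text \<open>Objective of the \<open>u\<close>-subproblem: \<open>gf2\<close> is the gradient of \<open>f2\<close>, \<open>s\<close> stands for
  \<open>t (k + 1)\<close>, \<open>l\<close> for the current multiplier, \<open>xbar\<close> for the extrapolated point and
  \<open>v\<close> for \<open>u k\<close>.\<close>

definition subproblem ::
  "(real^'m \<Rightarrow> ereal) \<Rightarrow> (real^'m \<Rightarrow> real^'m) \<Rightarrow> real^'m^'p \<Rightarrow> real^'p \<Rightarrow> real \<Rightarrow> real \<Rightarrow>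
   real \<Rightarrow> real^'p \<Rightarrow> real^'m \<Rightarrow> real^'m \<Rightarrow> real^'m \<Rightarrow> ereal" where
  "subproblem f1 gf2 A b \<alpha> \<gamma> s l xbar v w =
     f1 w + ereal ((transpose A *v l + gf2 xbar) \<bullet> w
       + \<gamma> * s / 2 * (norm (A *v w - b))\<^sup>2
       + 1 / (2 * \<alpha> * s) * (norm (w - v))\<^sup>2)"

text \<open>Only \<open>x k\<close> for \<open>k \<ge> 0\<close> and \<open>u k\<close>, \<open>lam k\<close>, \<open>t k\<close> for \<open>k \<ge> 1\<close> are constrained.
  The initial multiplier \<open>lam 1\<close> is arbitrary, and \<open>edom f1\<close> is the domain of \<open>f1 + f2\<close>
  because \<open>f2\<close> is finite everywhere.\<close>

definition accelerated_alm ::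
  "(real^'m \<Rightarrow> ereal) \<Rightarrow> (real^'m \<Rightarrow> real^'m) \<Rightarrow> real^'m^'p \<Rightarrow> real^'p \<Rightarrow> real \<Rightarrow> real \<Rightarrow>
   (nat \<Rightarrow> real) \<Rightarrow> (nat \<Rightarrow> real^'m) \<Rightarrow> (nat \<Rightarrow> real^'m) \<Rightarrow> (nat \<Rightarrow> real^'p) \<Rightarrow> bool" where
  "accelerated_alm f1 gf2 A b \<alpha> \<gamma> t x u lam \<longleftrightarrow>
     x 1 = x 0 \<and> u 1 = x 0 \<and> x 0 \<in> edom f1 \<and>
     (\<forall>k\<ge>1.
        is_arg_min (subproblem f1 gf2 A b \<alpha> \<gamma> (t (k + 1)) (lam k) (extrapolated t x k) (u k))
          (\<lambda>_. True) (u (k + 1)) \<and>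
        x (k + 1) = (1 / t (k + 1)) *\<^sub>R u (k + 1) + ((t (k + 1) - 1) / t (k + 1)) *\<^sub>R x k \<and>
        lam (k + 1) = lam k + (\<gamma> * t (k + 1)) *\<^sub>R (A *v u (k + 1) - b))"

end

theory Submission imports Defs begin

text \<open>The Lyapunov function
  \<open>E k = (t k)\<^sup>2 * (f (x k) - f xs + ls \<bullet> (A x k - b)) + |u k - xs|\<^sup>2 / (2 \<alpha>) + |lam k - ls|\<^sup>2 / (2 \<gamma>)\<close>
  is nonincreasing: combine the optimality of \<open>u (k + 1)\<close>, where the penalty term turns
  \<open>lam k\<close> into \<open>lam (k + 1)\<close>, with the descent inequality for \<open>f2\<close> at the extrapolated point,
  which is the convex combination of \<open>u k\<close> and \<open>x k\<close> with the weights that form \<open>x (k + 1)\<close>.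
  This bounds the Lagrangian gap by \<open>E 1 / (t k)\<^sup>2\<close> and keeps the multipliers bounded.
  Summing the multiplier updates bounds \<open>g k + (\<Sum>i<k. a i * g i)\<close> for
  \<open>g k = (t (k + 1))\<^sup>2 * (A x (k + 1) - b)\<close> and weights \<open>a i\<close> in \<open>[0, 1]\<close>, which forces \<open>g\<close> to be
  bounded.\<close>

section \<open>Convex and smooth functions along segments\<close>

lemma gderiv_along_line:
  fixes f :: "'a::real_inner \<Rightarrow> real"
  assumes "GDERIV f (x + r *\<^sub>R d) :> g"
  shows "((\<lambda>r. f (x + r *\<^sub>R d)) has_real_derivative g \<bullet> d) (at r within S)"
proof -
  have f: "(f has_derivative (\<lambda>h. h \<bullet> g)) (at (x + r *\<^sub>R d))"
    using assms by (simp add: gderiv_def)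
  have l: "((\<lambda>r. x + r *\<^sub>R d) has_derivative (\<lambda>h. h *\<^sub>R d)) (at r within S)"
    by (auto intro!: derivative_eq_intros)
  have "((\<lambda>r. f (x + r *\<^sub>R d)) has_derivative (\<lambda>h. (h *\<^sub>R d) \<bullet> g)) (at r within S)"
    by (rule has_derivative_compose[OF l f])
  also have "(\<lambda>h. (h *\<^sub>R d) \<bullet> g) = (*) (g \<bullet> d)"
    by (simp add: fun_eq_iff inner_commute)
  finally show ?thesis by (simp add: has_field_derivative_def)
qed

text \<open>Restricting \<open>f\<close> to the line through \<open>x\<close> and \<open>y\<close>
  reduces this to the tangent bound for convex functions of one variable.\<close>

lemma convex_on_above_gradient:
  fixes f :: "'a::real_inner \<Rightarrow> real"
  assumes convex: "convex_on UNIV f" and grad: "GDERIV f x :> g"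
  shows "f x + g \<bullet> (y - x) \<le> f y"
proof -
  let ?h = "\<lambda>r. f (x + r *\<^sub>R (y - x))"
  have "convex_on UNIV ?h"
  proof (rule convex_onI)
    fix r a c :: real assume r: "0 < r" "r < 1"
    have "x + ((1 - r) *\<^sub>R a + r *\<^sub>R c) *\<^sub>R (y - x)
        = (1 - r) *\<^sub>R (x + a *\<^sub>R (y - x)) + r *\<^sub>R (x + c *\<^sub>R (y - x))"
      by (simp add: algebra_simps)
    then show "?h ((1 - r) *\<^sub>R a + r *\<^sub>R c) \<le> (1 - r) * ?h a + r * ?h c"
      using convex_onD[OF convex, of r] r by simp
  qed simp
  moreover have "(?h has_real_derivative g \<bullet> (y - x)) (at 0 within UNIV)"
    using gderiv_along_line[of f x 0 "y - x" g] grad by simp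
  ultimately have "?h 1 - ?h 0 \<ge> (g \<bullet> (y - x)) * (1 - 0)"
    by (intro convex_on_imp_above_tangent[where A = UNIV]) auto
  then show ?thesis by simp
qed

text \<open>Subtract the linear and quadratic terms of the bound from \<open>f\<close> along the
  segment: Cauchy-Schwarz and the Lipschitz condition make the derivative of the difference
  \<open>?h\<close> nonpositive, so \<open>?h 1 \<le> ?h 0\<close>.\<close>

lemma lipschitz_gradient_upper_bound:
  fixes f :: "'a::real_inner \<Rightarrow> real"
  assumes grad: "\<And>x. GDERIV f x :> g x" and lip: "L-lipschitz_on UNIV g"
  shows "f y \<le> f x + g x \<bullet> (y - x) + L / 2 * (norm (y - x))\<^sup>2"
proof -
  define d where "d = y - x"
  let ?h = "\<lambda>r. f (x + r *\<^sub>R d) - r * (g x \<bullet> d) - L / 2 * r\<^sup>2 * (norm d)\<^sup>2"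
  have "?h 1 \<le> ?h 0"
  proof (rule DERIV_nonpos_imp_nonincreasing[where a = 0 and b = 1])
    fix r :: real assume r: "0 \<le> r" "r \<le> 1"
    let ?D = "g (x + r *\<^sub>R d) \<bullet> d - g x \<bullet> d - L * r * (norm d)\<^sup>2"
    have "(?h has_real_derivative ?D) (at r)"
      by (auto intro!: derivative_eq_intros gderiv_along_line grad)
    moreover have "?D \<le> 0"
    proof -
      have "(g (x + r *\<^sub>R d) - g x) \<bullet> d \<le> norm (g (x + r *\<^sub>R d) - g x) * norm d"
        by (rule norm_cauchy_schwarz)
      also have "\<dots> \<le> (L * (r * norm d)) * norm d"
        using lipschitz_onD[OF lip, of "x + r *\<^sub>R d" x] r
        by (intro mult_right_mono) (auto simp: dist_norm)
      finally show ?thesis by (simp add: inner_diff_left power2_eq_square algebra_simps)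
    qed
    ultimately show "\<exists>D. (?h has_real_derivative D) (at r) \<and> D \<le> 0" by blast
  qed simp
  then show ?thesis by (simp add: d_def)
qed

text \<open>An optimality condition stated without subgradients of \<open>\<phi>\<close>. By
  convexity \<open>\<phi> v + ?h r\<close> majorizes the objective on the segment from
  \<open>v\<close> to \<open>w\<close>, with equality at \<open>r = 0\<close>. If the claim failed,
  \<open>?h\<close> would have negative slope there and a short step towards \<open>w\<close> would
  beat \<open>v\<close>.\<close>

lemma convex_plus_smooth_minimizer:
  fixes \<phi> q :: "'a::real_inner \<Rightarrow> real"
  assumes convex: "convex_on D \<phi>" and grad: "GDERIV q v :> g"
    and v: "v \<in> D" and w: "w \<in> D"
    and minimal: "\<And>z. z \<in> D \<Longrightarrow> \<phi> v + q v \<le> \<phi> z + q z"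
  shows "\<phi> v \<le> \<phi> w + g \<bullet> (w - v)"
proof (rule ccontr)
  assume less: "\<not> ?thesis"
  let ?h = "\<lambda>r. r * (\<phi> w - \<phi> v) + q (v + r *\<^sub>R (w - v))"
  have "(?h has_real_derivative (\<phi> w - \<phi> v) + g \<bullet> (w - v)) (at 0)"
    using grad by (auto intro!: derivative_eq_intros gderiv_along_line)
  then obtain e where e: "e > 0" "\<And>r. 0 < r \<Longrightarrow> r < e \<Longrightarrow> ?h (0 + r) < ?h 0"
    using DERIV_neg_dec_right[of ?h _ 0] less by force
  define r where "r = min 1 (e / 2)"
  have r: "0 < r" "r \<le> 1" "r < e" using e(1) by (auto simp: r_def)
  have comb: "v + r *\<^sub>R (w - v) = (1 - r) *\<^sub>R v + r *\<^sub>R w" by (simp add: algebra_simps)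
  have "v + r *\<^sub>R (w - v) \<in> D"
    unfolding comb using convexD[OF convex_on_imp_convex[OF convex] v w, of "1 - r" r] r by simp
  then have "\<phi> v + q v \<le> \<phi> (v + r *\<^sub>R (w - v)) + q (v + r *\<^sub>R (w - v))" by (rule minimal)
  moreover have "\<phi> (v + r *\<^sub>R (w - v)) \<le> (1 - r) * \<phi> v + r * \<phi> w"
    unfolding comb using convex_onD[OF convex, of r v w] r v w by simp
  ultimately have "?h 0 \<le> ?h r" by (simp add: algebra_simps)
  then show False using e(2)[of r] r by simp
qed

lemma subproblem_gradient:
  fixes A :: "real^'m^'p" and c v z :: "real^'m" and b :: "real^'p"
  shows "GDERIV (\<lambda>w. c \<bullet> w + \<beta> / 2 * (norm (A *v w - b))\<^sup>2 + \<delta> / 2 * (norm (w - v))\<^sup>2) z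
    :> c + \<beta> *\<^sub>R (transpose A *v (A *v z - b)) + \<delta> *\<^sub>R (z - v)"
proof -
  have A: "((\<lambda>w. A *v w) has_derivative (\<lambda>h. A *v h)) (at z)"
    by (rule bounded_linear_imp_has_derivative) (rule matrix_vector_mul_bounded_linear)
  have adj: "h \<bullet> (transpose A *v y) = (A *v h) \<bullet> y" for h y
    by (metis dot_lmul_matrix inner_commute transpose_matrix_vector)
  have "((\<lambda>w. c \<bullet> w + \<beta> / 2 * ((A *v w - b) \<bullet> (A *v w - b)) + \<delta> / 2 * ((w - v) \<bullet> (w - v)))
    has_derivative (\<lambda>h. c \<bullet> h + \<beta> / 2 * (2 * ((A *v h) \<bullet> (A *v z - b))) + \<delta> / 2 * (2 * (h \<bullet> (z - v))))) (at z)"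
    by (rule derivative_eq_intros A refl)+ (simp add: inner_commute)
  also have "(\<lambda>h. c \<bullet> h + \<beta> / 2 * (2 * ((A *v h) \<bullet> (A *v z - b))) + \<delta> / 2 * (2 * (h \<bullet> (z - v))))
    = (\<lambda>h. h \<bullet> (c + \<beta> *\<^sub>R (transpose A *v (A *v z - b)) + \<delta> *\<^sub>R (z - v)))"
    by (simp only: inner_add_right inner_scaleR_right adj) (simp add: inner_commute)
  finally show ?thesis by (simp add: gderiv_def power2_norm_eq_inner)
qed

text \<open>Each partial sum is a convex combination of the previous one and of \<open>g k\<close> plus the
  previous one, whence all partial sums have norm at most \<open>C\<close>.\<close>

lemma norm_le_of_weighted_partial_sums:
  fixes g :: "nat \<Rightarrow> 'a::real_normed_vector"
  assumes weights: "\<And>i. 0 \<le> a i \<and> a i \<le> 1"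
    and bound: "\<And>k. norm (g k + (\<Sum>i<k. a i *\<^sub>R g i)) \<le> C"
  shows "norm (g k) \<le> 2 * C"
proof -
  define S where "S k = (\<Sum>i<k. a i *\<^sub>R g i)" for k
  have C: "0 \<le> C" using bound[of 0] norm_ge_zero order_trans by blast
  have S: "norm (S k) \<le> C" for k
  proof (induction k)
    case 0 show ?case using C by (simp add: S_def)
  next
    case (Suc k)
    have "S (Suc k) = (1 - a k) *\<^sub>R S k + a k *\<^sub>R (g k + S k)"
      by (simp add: S_def algebra_simps)
    also have "norm \<dots> \<le> (1 - a k) * norm (S k) + a k * norm (g k + S k)"
      using weights[of k] by (metis abs_of_nonneg diff_ge_0_iff_ge norm_scaleR norm_triangle_ineq)
    also have "\<dots> \<le> (1 - a k) * C + a k * C"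
      using weights[of k] Suc bound[of k]
      by (intro add_mono mult_left_mono) (auto simp: S_def)
    finally show ?case by (simp add: algebra_simps)
  qed
  have "norm (g k) = norm ((g k + S k) - S k)" by simp
  also have "\<dots> \<le> C + C" using norm_triangle_le_diff[of "g k + S k" "S k"] S[of k] bound[of k]
    by (metis S_def add_mono norm_triangle_ineq4 order_trans)
  finally show ?thesis by simp
qed

text \<open>One iteration seen without the constraint: \<open>v\<close>, \<open>v'\<close> stand for
  \<open>u k\<close>, \<open>u (k + 1)\<close>, \<open>y\<close> for the extrapolated point,
  \<open>z\<close> for the saddle point and \<open>c\<close> for the multiplier term. Convexity is
  used with weight \<open>1 / s\<close> and everything is multiplied by
  \<open>s\<^sup>2\<close>.\<close>

lemma accelerated_step:
  fixes \<phi> f :: "'a::real_inner \<Rightarrow> real"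
  assumes convex_\<phi>: "convex_on D \<phi>" and D: "x \<in> D" "v' \<in> D"
    and convex_f: "convex_on UNIV f" and grad: "\<And>z. GDERIV f z :> g z"
    and lip: "L-lipschitz_on UNIV g"
    and s: "1 \<le> s" and \<alpha>: "0 < \<alpha>" "\<alpha> * L \<le> 1"
    and y: "y = (1 / s) *\<^sub>R v + (1 - 1 / s) *\<^sub>R x"
    and x': "x' = (1 / s) *\<^sub>R v' + (1 - 1 / s) *\<^sub>R x"
    and opt: "\<phi> v' \<le> \<phi> z + (c + g y + (1 / (\<alpha> * s)) *\<^sub>R (v' - v)) \<bullet> (z - v')"
  shows "s\<^sup>2 * (\<phi> x' + f x') + 1 / (2 * \<alpha>) * (norm (v' - z))\<^sup>2
    \<le> (s\<^sup>2 - s) * (\<phi> x + f x) + s * (\<phi> z + f z) + s * (c \<bullet> (z - v'))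
      + 1 / (2 * \<alpha>) * (norm (v - z))\<^sup>2"
proof -
  have r: "0 \<le> 1 / s" "1 / s \<le> 1" "s \<noteq> 0" using s by auto
  \<comment> \<open>\<open>y\<close> and \<open>x'\<close> share their weights, so the quadratic
    descent error carries a factor \<open>1 / s\<^sup>2\<close> that the multiplication by
    \<open>s\<^sup>2\<close> removes.\<close>
  have step: "x' - y = (1 / s) *\<^sub>R (v' - v)" by (simp add: x' y algebra_simps)
  \<comment> \<open>The linearization at \<open>y\<close> splits over the weights of
    \<open>x'\<close>, with a detour through \<open>z\<close>. The gradient inequality then applies
    at \<open>z\<close> and \<open>x\<close>, and the remainder
    \<open>g y \<bullet> (v' - z)\<close> cancels against the \<open>g y\<close> term of
    \<open>opt\<close>.\<close>
  have lin: "f y + g y \<bullet> (x' - y)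
      = (1 / s) * (f y + g y \<bullet> (z - y) + g y \<bullet> (v' - z)) + (1 - 1 / s) * (f y + g y \<bullet> (x - y))"
    unfolding x' by (simp add: algebra_simps inner_simps)
  have "f x' \<le> f y + g y \<bullet> (x' - y) + L / 2 * (norm (x' - y))\<^sup>2"
    by (rule lipschitz_gradient_upper_bound[OF grad lip])
  also have "\<dots> \<le> (1 / s) * (f z + g y \<bullet> (v' - z)) + (1 - 1 / s) * f x
      + L / 2 * ((norm (v' - v))\<^sup>2 / s\<^sup>2)"
  proof -
    have "L / 2 * (norm (x' - y))\<^sup>2 = L / 2 * ((norm (v' - v))\<^sup>2 / s\<^sup>2)"
      unfolding step by (simp add: power_divide power_mult_distrib)
    moreover have "(1 / s) * (f y + g y \<bullet> (z - y) + g y \<bullet> (v' - z)) + (1 - 1 / s) * (f y + g y \<bullet> (x - y))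
        \<le> (1 / s) * (f z + g y \<bullet> (v' - z)) + (1 - 1 / s) * f x"
      using convex_on_above_gradient[OF convex_f grad, of y] r
      by (intro add_mono mult_left_mono) auto
    ultimately show ?thesis unfolding lin by linarith
  qed
  finally have f: "f x' \<le> \<dots>" .
  have "\<phi> x' \<le> (1 / s) * \<phi> v' + (1 - 1 / s) * \<phi> x"
    unfolding x' using convex_onD[OF convex_\<phi>, of "1 / s" x v'] r D by (simp add: add.commute)
  also have "\<dots> \<le> (1 / s) * (\<phi> z + (c + g y + (1 / (\<alpha> * s)) *\<^sub>R (v' - v)) \<bullet> (z - v')) + (1 - 1 / s) * \<phi> x"
    using opt r by (intro add_right_mono mult_left_mono) auto
  finally have p: "\<phi> x' \<le> \<dots>" .
  have "s\<^sup>2 * (\<phi> x' + f x') \<le> s\<^sup>2 * ((1 / s) * (\<phi> z + (c + g y + (1 / (\<alpha> * s)) *\<^sub>R (v' - v)) \<bullet> (z - v'))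
      + (1 - 1 / s) * \<phi> x + ((1 / s) * (f z + g y \<bullet> (v' - z)) + (1 - 1 / s) * f x
      + L / 2 * ((norm (v' - v))\<^sup>2 / s\<^sup>2)))"
    using add_mono[OF p f] by (intro mult_left_mono) auto
  also have "\<dots> = (s\<^sup>2 - s) * (\<phi> x + f x) + s * (\<phi> z + f z) + s * (c \<bullet> (z - v'))
      + (1 / \<alpha>) * ((v' - v) \<bullet> (z - v')) + L / 2 * (norm (v' - v))\<^sup>2"
    using r \<alpha> by (simp add: inner_simps field_simps power2_eq_square)
  \<comment> \<open>The step-size condition replaces \<open>L / 2\<close> by
    \<open>1 / (2 * \<alpha>)\<close>; the three-point identity below cancels the resulting square
    of \<open>v' - v\<close>.\<close>
  also have "\<dots> \<le> (s\<^sup>2 - s) * (\<phi> x + f x) + s * (\<phi> z + f z) + s * (c \<bullet> (z - v'))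
      + (1 / \<alpha>) * ((v' - v) \<bullet> (z - v')) + 1 / (2 * \<alpha>) * (norm (v' - v))\<^sup>2"
  proof -
    have "L / 2 * (norm (v' - v))\<^sup>2 \<le> 1 / (2 * \<alpha>) * (norm (v' - v))\<^sup>2"
      using \<alpha> by (intro mult_right_mono) (auto simp: field_simps)
    then show ?thesis by simp
  qed
  also have "(1 / \<alpha>) * ((v' - v) \<bullet> (z - v'))
      = 1 / (2 * \<alpha>) * ((norm (v - z))\<^sup>2 - (norm (v' - z))\<^sup>2 - (norm (v' - v))\<^sup>2)"
    using \<alpha> by (simp add: power2_norm_eq_inner inner_simps inner_commute field_simps)
  finally show ?thesis by (simp add: right_diff_distrib)
qed


section \<open>From extended-real functions and saddle points to real inequalities\<close>

lemma convex_on_real_of_ereal: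
  assumes convex: "econvex_fun F" and range: "\<And>x. F x \<noteq> -\<infinity>"
  shows "convex_on (edom F) (\<lambda>x. real_of_ereal (F x))"
proof -
  have fin: "F x = ereal (real_of_ereal (F x))" if "x \<in> edom F" for x
    using that range[of x] by (cases "F x") (auto simp: edom_def)
  have le: "F (c *\<^sub>R x + d *\<^sub>R y) \<le> ereal (c * real_of_ereal (F x) + d * real_of_ereal (F y))"
    if xy: "x \<in> edom F" "y \<in> edom F" and c: "0 \<le> c" "0 \<le> d" "c + d = 1" for x y c d
  proof -
    have "c \<in> {0..1}" "d = 1 - c" using c by auto
    then have "F (c *\<^sub>R x + d *\<^sub>R y) \<le> ereal c * F x + ereal d * F y"
      using convex unfolding econvex_fun_def by blast
    also have "\<dots> = ereal (c * real_of_ereal (F x) + d * real_of_ereal (F y))"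
      using fin[OF xy(1)] fin[OF xy(2)] by (metis plus_ereal.simps(1) times_ereal.simps(1))
    finally show ?thesis .
  qed
  have mem: "c *\<^sub>R x + d *\<^sub>R y \<in> edom F"
    if "x \<in> edom F" "y \<in> edom F" "0 \<le> c" "0 \<le> d" "c + d = 1" for x y c d
    using le[OF that] by (auto simp: edom_def)
  show ?thesis
    unfolding convex_on_def
  proof (intro conjI ballI allI impI)
    show "convex (edom F)" using mem by (auto simp: convex_def)
    fix x y c d :: _ assume *: "x \<in> edom F" "y \<in> edom F" "0 \<le> (c::real)" "0 \<le> d" "c + d = 1"
    show "real_of_ereal (F (c *\<^sub>R x + d *\<^sub>R y)) \<le> c * real_of_ereal (F x) + d * real_of_ereal (F y)"
      using le[OF *] fin[OF mem[OF *]] by (metis ereal_less_eq(3))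
  qed
qed

lemma saddle_pointD:
  assumes saddle: "(xs, ls) \<in> saddle_points F A b" and range: "\<And>x. F x \<noteq> -\<infinity>" and x: "x \<in> edom F"
  shows "xs \<in> edom F" "A *v xs = b"
    "real_of_ereal (F xs) \<le> real_of_ereal (F x) + ls \<bullet> (A *v x - b)"
proof -
  have le: "F xs + ereal (l \<bullet> (A *v xs - b)) \<le> F xs + ereal (ls \<bullet> (A *v xs - b))"
    "F xs + ereal (ls \<bullet> (A *v xs - b)) \<le> F z + ereal (ls \<bullet> (A *v z - b))" for l z
    using saddle by (auto simp: saddle_points_def lagrangian_def)
  obtain r where r: "F x = ereal r" using x range[of x] by (cases "F x") (auto simp: edom_def)
  \<comment> \<open>The right saddle inequality compares \<open>F xs\<close> with the finite value
    at \<open>x\<close>, so \<open>F xs\<close> is finite too.\<close>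
  obtain rs where rs: "F xs = ereal rs"
    using le(2)[of x] range[of xs] r by (cases "F xs") auto
  show "xs \<in> edom F" by (simp add: edom_def rs)
  \<comment> \<open>Moving the multiplier by the residual itself makes the squared residual
    nonpositive, hence \<open>xs\<close> is feasible.\<close>
  have "(ls + (A *v xs - b)) \<bullet> (A *v xs - b) \<le> ls \<bullet> (A *v xs - b)"
    using le(1)[of "ls + (A *v xs - b)"] by (simp add: rs)
  then have "(A *v xs - b) \<bullet> (A *v xs - b) \<le> 0" by (simp add: inner_add_left)
  then have "(A *v xs - b) \<bullet> (A *v xs - b) = 0" by (intro antisym inner_ge_zero)
  then show A: "A *v xs = b" by simp
  show "real_of_ereal (F xs) \<le> real_of_ereal (F x) + ls \<bullet> (A *v x - b)"
    using le(2)[of x] by (simp add: r rs A)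
qed

section \<open>Algebraic identities between the sequences of the algorithm\<close>

lemma accelerated_alm_u:
  assumes alg: "accelerated_alm f1 g A b \<alpha> \<gamma> t x u lam" and t: "\<And>k. 1 \<le> k \<Longrightarrow> 1 \<le> t k" and k: "1 \<le> k"
  shows "u k = x k + (t k - 1) *\<^sub>R (x k - x (k - 1))"
proof (cases "k = 1")
  \<comment> \<open>Here \<open>k - 1\<close> is 0 and \<open>x 1 = x 0\<close>, so the momentum
    term vanishes and the claim reads \<open>u 1 = x 1\<close>.\<close>
  case True
  then show ?thesis using alg by (simp add: accelerated_alm_def)
next
  case False
  then obtain j where j: "k = j + 1" "1 \<le> j" using that[of "k - 1"] k by simp
  have t0: "t k \<noteq> 0" using t[OF k] by simp
  have "x k = (1 / t k) *\<^sub>R u k + ((t k - 1) / t k) *\<^sub>R x j"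
    using alg j by (simp add: accelerated_alm_def)
  then have "t k *\<^sub>R x k = u k + (t k - 1) *\<^sub>R x j" using t0 by (simp add: scaleR_add_right)
  then show ?thesis using j by (simp add: algebra_simps)
qed

text \<open>Brings the extrapolated point into the form required of \<open>y\<close> in
  \<open>accelerated_step\<close>.\<close>

lemma extrapolated_eq:
  assumes "accelerated_alm f1 g A b \<alpha> \<gamma> t x u lam" and t: "\<And>k. 1 \<le> k \<Longrightarrow> 1 \<le> t k" and "1 \<le> k"
  shows "extrapolated t x k = (1 / t (k + 1)) *\<^sub>R u k + (1 - 1 / t (k + 1)) *\<^sub>R x k"
proof -
  have "u k - x k = (t k - 1) *\<^sub>R (x k - x (k - 1))" using accelerated_alm_u[OF assms] by simp
  then have "extrapolated t x k = x k + (1 / t (k + 1)) *\<^sub>R (u k - x k)"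
    by (simp add: extrapolated_def)
  then show ?thesis by (simp add: algebra_simps)
qed

theorem theorem7:
  fixes f1 f :: "real^'m \<Rightarrow> ereal" and f2 :: "real^'m \<Rightarrow> real"
    and gf2 :: "real^'m \<Rightarrow> real^'m" and L :: real
    and A :: "real^'m^'p" and b :: "real^'p"
    and \<alpha> \<gamma> :: real and t :: "nat \<Rightarrow> real"
    and x u :: "nat \<Rightarrow> real^'m" and lam :: "nat \<Rightarrow> real^'p"
    and xs :: "real^'m" and ls :: "real^'p"
    and E1 C3 :: real
  assumes f1_range: "\<forall>y. f1 y \<noteq> -\<infinity>"
    and f1_proper: "proper_fun f1"
    and f1_closed: "closed_fun f1"
    and f1_convex: "econvex_fun f1"
    and f2_convex: "convex_on UNIV f2"
    and f2_gradient: "\<forall>y. GDERIV f2 y :> gf2 y"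
    and f2_lipschitz: "L-lipschitz_on UNIV gf2"
    and f_eq: "f = (\<lambda>y. f1 y + ereal (f2 y))"
    and saddle_nonempty: "saddle_points f A b \<noteq> {}"
    and alpha_pos: "\<alpha> > 0" and gamma_pos: "\<gamma> > 0"
    and algorithm: "accelerated_alm f1 gf2 A b \<alpha> \<gamma> t x u lam"
    and saddle: "(xs, ls) \<in> saddle_points f A b"
    \<comment> \<open>\<open>1 / ereal 0 = \<infinity>\<close>, so nothing is required of \<open>\<alpha>\<close> when \<open>L = 0\<close>\<close>
    and alpha_le: "ereal \<alpha> \<le> 1 / ereal L"
    and t_ge_1: "\<forall>k\<ge>1. t k \<ge> 1"
    and t_mono: "mono_on {1..} t"
    and t_growth: "\<forall>k\<ge>1. (t (k + 1))\<^sup>2 \<le> (t k)\<^sup>2 + t (k + 1)"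
    \<comment> \<open>\<open>f (x 1)\<close> and \<open>f xs\<close> are finite, so \<open>real_of_ereal\<close> only changes the type\<close>
    and E1_eq: "E1 = (t 1)\<^sup>2 * (real_of_ereal (f (x 1)) - real_of_ereal (f xs) + ls \<bullet> (A *v x 1 - b))
      + 1 / (2 * \<alpha>) * (norm (x 1 - xs))\<^sup>2 + 1 / (2 * \<gamma>) * (norm (lam 1 - ls))\<^sup>2"
    and C3_eq: "C3 = 3 * (t 1)\<^sup>2 * norm (A *v x 1 - b)
      + (2 * norm (lam 1 - ls) + 2 * sqrt (2 * \<gamma> * E1)) / \<gamma>"
  shows "\<forall>k\<ge>1. norm (A *v x k - b) \<le> C3 / (t k)\<^sup>2 \<and>
    \<bar>f (x k) - f xs\<bar> \<le> ereal ((E1 + C3 * norm ls) / (t k)\<^sup>2)"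
proof -

  \<comment> \<open>Passage to finite values and optimality of \<open>u (k + 1)\<close>\<close>
  define \<phi> where "\<phi> y = real_of_ereal (f1 y)" for y
  define F where "F y = \<phi> y + f2 y" for y
  define r where "r k = A *v x k - b" for k
  define gap where "gap k = F (x k) - F xs + ls \<bullet> r k" for k
  define E where "E k = (t k)\<^sup>2 * gap k + 1 / (2 * \<alpha>) * (norm (u k - xs))\<^sup>2
    + 1 / (2 * \<gamma>) * (norm (lam k - ls))\<^sup>2" for k
  let ?D = "edom f1"
  have alg: "x 1 = x 0" "u 1 = x 0" "x 0 \<in> ?D"
    and argmin: "\<And>k. 1 \<le> k \<Longrightarrow> is_arg_min (subproblem f1 gf2 A b \<alpha> \<gamma> (t (k + 1)) (lam k)
      (extrapolated t x k) (u k)) (\<lambda>_. True) (u (k + 1))"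
    and x_Suc: "\<And>k. 1 \<le> k \<Longrightarrow> x (k + 1) = (1 / t (k + 1)) *\<^sub>R u (k + 1) + ((t (k + 1) - 1) / t (k + 1)) *\<^sub>R x k"
    and lam_Suc: "\<And>k. 1 \<le> k \<Longrightarrow> lam (k + 1) = lam k + (\<gamma> * t (k + 1)) *\<^sub>R (A *v u (k + 1) - b)"
    using algorithm by (auto simp: accelerated_alm_def)
  have t1: "1 \<le> t k" if "1 \<le> k" for k using t_ge_1 that by blast
  have \<phi>_conv: "convex_on ?D \<phi>"
    using convex_on_real_of_ereal[OF f1_convex] f1_range by (simp add: \<phi>_def[abs_def])
  have f1: "f1 y = ereal (\<phi> y)" if "y \<in> ?D" for y
    using that f1_range[rule_format, of y] by (cases "f1 y") (auto simp: edom_def \<phi>_def)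
  have f: "f y = ereal (F y)" if "y \<in> ?D" for y
    using f1[OF that] by (simp add: f_eq F_def)
  have dom: "edom f = ?D" by (auto simp: edom_def f_eq)
  have f_range: "f y \<noteq> -\<infinity>" for y
    using f1_range[rule_format, of y] by (cases "f1 y") (auto simp: f_eq)
  have xs: "xs \<in> ?D" and Axs: "A *v xs = b"
    using saddle_pointD(1,2)[OF saddle f_range] alg(3) unfolding dom by auto
  have opt: "F xs \<le> F y + ls \<bullet> (A *v y - b)" if "y \<in> ?D" for y
    using saddle_pointD(3)[OF saddle f_range, of y] that xs by (simp add: dom f)
  have \<alpha>L: "\<alpha> * L \<le> 1"
  proof (cases "L = 0")
    case False
    then have "L > 0" using lipschitz_on_nonneg[OF f2_lipschitz] by simp
    then show ?thesis using alpha_le by (simp add: one_ereal_def field_simps)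
  qed simp
  \<comment> \<open>Outside the domain the objective is infinite, whereas \<open>xs\<close> gives it
    a finite value.\<close>
  have u_D: "u (k + 1) \<in> ?D" if k: "1 \<le> k" for k
  proof (rule ccontr)
    assume "u (k + 1) \<notin> ?D"
    then have "f1 (u (k + 1)) = \<infinity>" by (simp add: edom_def)
    then show False using argmin[OF k] f1[OF xs]
      unfolding is_arg_min_def subproblem_def
      by (metis ereal_less_PInfty PInfty_neq_ereal(1) plus_ereal.simps(1,2) ereal_less(4))
  qed
  have u_min: "\<phi> (u (k + 1)) \<le> \<phi> xs + (transpose A *v lam (k + 1) + gf2 (extrapolated t x k)
      + (1 / (\<alpha> * t (k + 1))) *\<^sub>R (u (k + 1) - u k)) \<bullet> (xs - u (k + 1))" if k: "1 \<le> k" for k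
  proof -
    let ?s = "t (k + 1)"
    let ?c = "transpose A *v lam k + gf2 (extrapolated t x k)"
    let ?q = "\<lambda>w. ?c \<bullet> w + \<gamma> * ?s / 2 * (norm (A *v w - b))\<^sup>2 + 1 / (\<alpha> * ?s) / 2 * (norm (w - u k))\<^sup>2"
    have sub: "subproblem f1 gf2 A b \<alpha> \<gamma> ?s (lam k) (extrapolated t x k) (u k) w = ereal (\<phi> w + ?q w)"
      if "w \<in> ?D" for w
      using f1[OF that] by (simp add: subproblem_def mult.commute mult.left_commute)
    have "\<phi> (u (k + 1)) + ?q (u (k + 1)) \<le> \<phi> w + ?q w" if "w \<in> ?D" for w
      using argmin[OF k] sub[OF that] sub[OF u_D[OF k]] unfolding is_arg_min_def
      by (metis ereal_less_eq(3) not_le)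
    then have "\<phi> (u (k + 1)) \<le> \<phi> xs + (?c + (\<gamma> * ?s) *\<^sub>R (transpose A *v (A *v u (k + 1) - b))
        + (1 / (\<alpha> * ?s)) *\<^sub>R (u (k + 1) - u k)) \<bullet> (xs - u (k + 1))"
      by (intro convex_plus_smooth_minimizer[OF \<phi>_conv subproblem_gradient u_D[OF k] xs])
    also have "?c + (\<gamma> * ?s) *\<^sub>R (transpose A *v (A *v u (k + 1) - b))
      = transpose A *v lam (k + 1) + gf2 (extrapolated t x k)"
      unfolding lam_Suc[OF k] by (simp add: matrix_vector_right_distrib matrix_vector_mult_scaleR del: transpose_matrix_vector)
    finally show ?thesis .
  qed

  \<comment> \<open>Primal iterates and their residuals\<close>
  have x_Suc': "x (k + 1) = (1 / t (k + 1)) *\<^sub>R u (k + 1) + (1 - 1 / t (k + 1)) *\<^sub>R x k" if "1 \<le> k" for k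
    using x_Suc[OF that] t1[of "k + 1"] by (simp add: diff_divide_distrib)
  have x_D: "x k \<in> ?D" if "1 \<le> k" for k
    using that
  proof (induction k rule: dec_induct)
    case base show ?case using alg by simp
  next
    case (step k)
    then show ?case
      using x_Suc'[of k] convexD[OF convex_on_imp_convex[OF \<phi>_conv] u_D[of k], of "x k" "1 / t (k + 1)" "1 - 1 / t (k + 1)"]
        t1[of "k + 1"] by simp
  qed
  have gap_nonneg: "0 \<le> gap k" if "1 \<le> k" for k
    using opt[OF x_D[OF that]] by (simp add: gap_def r_def)
  \<comment> \<open>The multiplier increment divided by \<open>\<gamma>\<close>. The coefficients of
    \<open>r (k + 1)\<close> and \<open>r k\<close> are those of the function values in
    \<open>accelerated_step\<close>, so both combine into gaps.\<close>
  have r_Suc: "t (k + 1) *\<^sub>R (A *v u (k + 1) - b)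
      = (t (k + 1))\<^sup>2 *\<^sub>R r (k + 1) - ((t (k + 1))\<^sup>2 - t (k + 1)) *\<^sub>R r k" if k: "1 \<le> k" for k
  proof -
    define s where "s = t (k + 1)"
    have s: "s \<noteq> 0" using t1[of "k + 1"] by (simp add: s_def)
    have "u (k + 1) = s *\<^sub>R x (k + 1) - (s - 1) *\<^sub>R x k"
      using s unfolding x_Suc'[OF k] s_def[symmetric] by (simp add: algebra_simps)
    then have "A *v u (k + 1) = s *\<^sub>R (A *v x (k + 1)) - (s - 1) *\<^sub>R (A *v x k)"
      by (simp only: matrix_vector_mult_diff_distrib matrix_vector_mult_scaleR)
    then have "A *v u (k + 1) - b = s *\<^sub>R r (k + 1) - (s - 1) *\<^sub>R r k"
      by (simp add: r_def algebra_simps)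
    then have "s *\<^sub>R (A *v u (k + 1) - b) = s *\<^sub>R (s *\<^sub>R r (k + 1) - (s - 1) *\<^sub>R r k)"
      by (rule arg_cong)
    then show ?thesis unfolding s_def[symmetric]
      by (simp only: scaleR_diff_right scaleR_scaleR right_diff_distrib power2_eq_square mult_1_right)
  qed

  \<comment> \<open>Decrease of the Lyapunov function and its consequences\<close>
  have E_step: "E (k + 1) \<le> E k" if k: "1 \<le> k" for k
  proof -
    define s where "s = t (k + 1)"
    have s: "1 \<le> s" using t1[of "k + 1"] by (simp add: s_def)
    define l where "l = lam (k + 1)"
    have "s\<^sup>2 * F (x (k + 1)) + 1 / (2 * \<alpha>) * (norm (u (k + 1) - xs))\<^sup>2
      \<le> (s\<^sup>2 - s) * F (x k) + s * F xs + s * ((transpose A *v l) \<bullet> (xs - u (k + 1)))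
        + 1 / (2 * \<alpha>) * (norm (u k - xs))\<^sup>2"
      unfolding F_def s_def l_def
      by (rule accelerated_step[OF \<phi>_conv x_D[OF k] u_D[OF k] f2_convex _ f2_lipschitz _ alpha_pos \<alpha>L
          extrapolated_eq[OF algorithm t1 k] x_Suc'[OF k] u_min[OF k]])
        (use f2_gradient t1 in auto)
    moreover have "(transpose A *v l) \<bullet> (xs - u (k + 1)) = - (l \<bullet> (A *v u (k + 1) - b))"
      by (simp add: dot_lmul_matrix matrix_vector_mult_diff_distrib Axs inner_diff_right)
    ultimately have 1: "s\<^sup>2 * F (x (k + 1)) + 1 / (2 * \<alpha>) * (norm (u (k + 1) - xs))\<^sup>2
      \<le> (s\<^sup>2 - s) * F (x k) + s * F xs - l \<bullet> (s *\<^sub>R (A *v u (k + 1) - b))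
        + 1 / (2 * \<alpha>) * (norm (u k - xs))\<^sup>2" by simp
    \<comment> \<open>Adding this to 1 completes the function values to gaps and turns
      \<open>l\<close> into \<open>l - ls\<close>.\<close>
    have 2: "ls \<bullet> (s *\<^sub>R (A *v u (k + 1) - b)) = s\<^sup>2 * (ls \<bullet> r (k + 1)) - (s\<^sup>2 - s) * (ls \<bullet> r k)"
      using r_Suc[OF k] by (simp add: s_def inner_diff_right)
    \<comment> \<open>The increment is \<open>(l - lam k) / \<gamma>\<close>; the three-point
      identity applies and the square of \<open>l - lam k\<close> is dropped.\<close>
    have 3: "(l - ls) \<bullet> (s *\<^sub>R (A *v u (k + 1) - b))
      \<ge> 1 / (2 * \<gamma>) * (norm (l - ls))\<^sup>2 - 1 / (2 * \<gamma>) * (norm (lam k - ls))\<^sup>2"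
    proof -
      have "s *\<^sub>R (A *v u (k + 1) - b) = (1 / \<gamma>) *\<^sub>R (l - lam k)"
        using gamma_pos lam_Suc[OF k] by (simp add: l_def s_def)
      then have "(l - ls) \<bullet> (s *\<^sub>R (A *v u (k + 1) - b)) = (1 / \<gamma>) * ((l - ls) \<bullet> (l - lam k))" by simp
      also have "\<dots> = 1 / (2 * \<gamma>) * ((norm (l - ls))\<^sup>2 - (norm (lam k - ls))\<^sup>2 + (norm (l - lam k))\<^sup>2)"
        using gamma_pos by (simp add: power2_norm_eq_inner inner_simps inner_commute field_simps)
      finally show ?thesis using gamma_pos by (simp add: distrib_left right_diff_distrib)
    qed
    have "(s\<^sup>2 - s) * gap k \<le> (t k)\<^sup>2 * gap k"
      using t_growth k gap_nonneg[OF k] by (intro mult_right_mono) (auto simp: s_def)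
    then show ?thesis
      using 1 2 3 unfolding E_def s_def[symmetric] l_def[symmetric]
      by (simp add: gap_def inner_diff_left algebra_simps)
  qed
  \<comment> \<open>The distance term agrees because \<open>u 1 = x 0 = x 1\<close>.\<close>
  have E1: "E 1 = E1"
    using alg x_D[of 1] xs by (simp add: E_def E1_eq gap_def r_def f)
  have E_le: "E k \<le> E1" if "1 \<le> k" for k
    using that
  proof (induction k rule: dec_induct)
    case base show ?case using E1 by simp
  next
    case (step k) then show ?case using E_step[of k] by simp
  qed
  have gap_le: "(t k)\<^sup>2 * gap k \<le> E1" if "1 \<le> k" for k
  proof -
    have "(t k)\<^sup>2 * gap k \<le> E k" using alpha_pos gamma_pos by (simp add: E_def)
    then show ?thesis using E_le[OF that] by simp
  qed
  have lam_le: "norm (lam k - ls) \<le> sqrt (2 * \<gamma> * E1)" if "1 \<le> k" for k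
  proof (rule real_le_rsqrt)
    have "1 / (2 * \<gamma>) * (norm (lam k - ls))\<^sup>2 \<le> E k"
      using alpha_pos gap_nonneg[OF that] by (simp add: E_def)
    then have "1 / (2 * \<gamma>) * (norm (lam k - ls))\<^sup>2 \<le> E1" using E_le[OF that] by simp
    then show "(norm (lam k - ls))\<^sup>2 \<le> 2 * \<gamma> * E1" using gamma_pos by (simp add: field_simps)
  qed

  \<comment> \<open>Residual bound from weighted partial sums\<close>
  define g where "g k = (t (k + 1))\<^sup>2 *\<^sub>R r (k + 1)" for k
  \<comment> \<open>Chosen so that \<open>g k - a k *\<^sub>R g k\<close> is the multiple of
    \<open>r (k + 1)\<close> subtracted in the next multiplier update; the sum in
    \<open>g_sum\<close> then telescopes.\<close>
  define a where "a k = ((t (k + 1))\<^sup>2 - (t (k + 2))\<^sup>2 + t (k + 2)) / (t (k + 1))\<^sup>2" for k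
  have g_sum: "g k + (\<Sum>i<k. a i *\<^sub>R g i) = g 0 + (1 / \<gamma>) *\<^sub>R (lam (k + 1) - lam 1)" for k
  proof (induction k)
    case 0 show ?case by simp
  next
    case (Suc k)
    let ?P = "((t (k + 2))\<^sup>2 - t (k + 2)) *\<^sub>R r (k + 1)"
    have "t (k + 1) \<noteq> 0" using t1[of "k + 1"] by simp
    then have "a k *\<^sub>R g k = ((t (k + 1))\<^sup>2 - ((t (k + 2))\<^sup>2 - t (k + 2))) *\<^sub>R r (k + 1)"
      by (simp add: a_def g_def)
    then have "a k *\<^sub>R g k = g k - ?P" by (simp only: g_def scaleR_diff_left)
    moreover have "(1 / \<gamma>) *\<^sub>R (lam (k + 2) - lam (k + 1)) = g (Suc k) - ?P"
      using lam_Suc[of "k + 1"] r_Suc[of "k + 1"] gamma_pos by (simp add: g_def)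
    ultimately have "g (Suc k) + a k *\<^sub>R g k = g k + (1 / \<gamma>) *\<^sub>R (lam (k + 2) - lam (k + 1))"
      by simp
    then have "g (Suc k) + (\<Sum>i<Suc k. a i *\<^sub>R g i)
        = (g k + (\<Sum>i<k. a i *\<^sub>R g i)) + (1 / \<gamma>) *\<^sub>R (lam (k + 2) - lam (k + 1))"
      by (simp add: algebra_simps)
    then show ?case unfolding Suc by (simp add: scaleR_diff_right)
  qed
  have r_le: "(t k)\<^sup>2 * norm (r k) \<le> C3" if k: "1 \<le> k" for k
  proof -
    define C where "C = norm (g 0) + (norm (lam 1 - ls) + sqrt (2 * \<gamma> * E1)) / \<gamma>"
    have "norm (g (k - 1)) \<le> 2 * C"
    proof (rule norm_le_of_weighted_partial_sums[where a = a])
      fix i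
      \<comment> \<open>The growth condition gives \<open>0 \<le> a i\<close>, and
        \<open>t (i + 2) \<le> (t (i + 2))\<^sup>2\<close> gives \<open>a i \<le> 1\<close>.\<close>
      have "1 \<le> t (i + 1)" "1 \<le> t (i + 2)" using t1 by auto
      moreover have "(t (i + 2))\<^sup>2 \<le> (t (i + 1))\<^sup>2 + t (i + 2)" using t_growth[rule_format, of "i + 1"] by simp
      moreover have "t (i + 2) \<le> (t (i + 2))\<^sup>2" using t1[of "i + 2"] by (simp add: power2_eq_square)
      ultimately show "0 \<le> a i \<and> a i \<le> 1" by (simp add: a_def divide_le_eq)
    next
      fix i
      have "norm (lam (i + 1) - lam 1) \<le> norm (lam 1 - ls) + sqrt (2 * \<gamma> * E1)"
        using norm_triangle_ineq4[of "lam (i + 1) - ls" "lam 1 - ls"] lam_le[of "i + 1"] by simp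
      then have "norm ((1 / \<gamma>) *\<^sub>R (lam (i + 1) - lam 1)) \<le> (norm (lam 1 - ls) + sqrt (2 * \<gamma> * E1)) / \<gamma>"
        using gamma_pos by (simp add: divide_right_mono)
      then show "norm (g i + (\<Sum>j<i. a j *\<^sub>R g j)) \<le> C"
        unfolding g_sum C_def by (intro order_trans[OF norm_triangle_ineq] add_left_mono)
    qed
    \<comment> \<open>The two sides differ only in the coefficient of the initial residual term, 2
      against 3.\<close>
    also have "2 * C \<le> C3"
    proof -
      have "norm (g 0) = (t 1)\<^sup>2 * norm (A *v x 1 - b)" by (simp add: g_def r_def)
      moreover have "0 \<le> (t 1)\<^sup>2 * norm (A *v x 1 - b)" by simp
      ultimately show ?thesis by (simp add: C_def C3_eq add_divide_distrib)
    qed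
    finally show ?thesis using k by (simp add: g_def)
  qed

  \<comment> \<open>Final estimates\<close>
  show ?thesis
  proof (intro allI impI)
    fix k :: nat assume k: "1 \<le> k"
    have t: "0 < (t k)\<^sup>2" using t1[OF k] by (simp add: zero_less_power)
    have r: "norm (r k) \<le> C3 / (t k)\<^sup>2" using r_le[OF k] t by (simp add: field_simps)
    have gap: "gap k \<le> E1 / (t k)\<^sup>2" using gap_le[OF k] t by (simp add: field_simps)
    \<comment> \<open>The objective error is \<open>gap k - ls \<bullet> r k\<close>, where the gap
      lies between 0 and \<open>E1 / (t k)\<^sup>2\<close>.\<close>
    have "\<bar>ls \<bullet> r k\<bar> \<le> norm ls * norm (r k)" by (rule Cauchy_Schwarz_ineq2)
    also have "\<dots> \<le> norm ls * (C3 / (t k)\<^sup>2)" by (intro mult_left_mono r) simp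
    finally have "\<bar>F (x k) - F xs\<bar> \<le> E1 / (t k)\<^sup>2 + norm ls * (C3 / (t k)\<^sup>2)"
      using gap gap_nonneg[OF k] by (simp add: gap_def)
    then show "norm (A *v x k - b) \<le> C3 / (t k)\<^sup>2 \<and>
      \<bar>f (x k) - f xs\<bar> \<le> ereal ((E1 + C3 * norm ls) / (t k)\<^sup>2)"
      using r x_D[OF k] xs by (simp add: r_def f add_divide_distrib mult.commute)
  qed
qed

end
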